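(* Let $p,q$ be positive integers, let $E \subseteq [p]\times[q]$, and let $M_E \in \mathbb{R}_{\geq 0}^E$ be a partial matrix with nonnegative entries. Then $M_E$ has a nonnegative rank-$2$ completion (a completion in $\mathbb{R}_{\ge 0}^{p\times q}$ of nonnegative rank $2$) if and only if $M_E$ has a rank-$2$ completion all of whose entries are nonnegative.
   Context: $[n]=\{1,\dots,n\}$. For $E \subseteq [p]\times[q]$, a partial matrix $M_E=(m_{ij})_{(i,j)\in E} \in \mathbb{R}^E$ specifies the entries in the positions $E$; the other positions are missing. A completion of $M_E$ is a matrix in $\mathbb{R}^{p\times q}$ that agrees with $M_E$ on $E$. The nonnegative rank of $M\in\mathbb{R}_{\ge 0}^{p\times q}$ is the smallest $r$ such that $M=AB$ with $A\in\mathbb{R}_{\ge 0}^{p\times r}$, $B\in\mathbb{R}_{\ge 0}^{r\times q}$. A rank-$r$ completion is a completion of rank $r$. *)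

theory Defs
  imports Complex_Main "Jordan_Normal_Form.DL_Rank"
begin

text \<open>
  Matrices are those of \<^theory>\<open>Jordan_Normal_Form.Matrix\<close>. Their entries are numbered from 0,
  so \<open>[p] \<times> [q]\<close> becomes \<open>{0..<p} \<times> {0..<q}\<close>.
\<close>

definition nonneg_mat :: "real mat \<Rightarrow> bool" where
  "nonneg_mat M \<longleftrightarrow> (\<forall>i<dim_row M. \<forall>j<dim_col M. M $$ (i, j) \<ge> 0)"

definition nonneg_factorization :: "nat \<Rightarrow> real mat \<Rightarrow> bool" where
  "nonneg_factorization r M \<longleftrightarrow>
     (\<exists>A \<in> carrier_mat (dim_row M) r. \<exists>B \<in> carrier_mat r (dim_col M).
        nonneg_mat A \<and> nonneg_mat B \<and> M = A * B)"

text \<open>The following is meaningful for nonnegative \<open>M\<close> only; see the lemma below.\<close>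

definition nonneg_rank :: "real mat \<Rightarrow> nat" where
  "nonneg_rank M = (LEAST r. nonneg_factorization r M)"

lemma nonneg_factorization_dim_col:
  assumes "nonneg_mat M"
  shows "nonneg_factorization (dim_col M) M"
  unfolding nonneg_factorization_def
proof (intro bexI conjI)
  show "nonneg_mat M" by (rule assms)
  show "nonneg_mat (1\<^sub>m (dim_col M))" by (auto simp: nonneg_mat_def)
  show "M = M * 1\<^sub>m (dim_col M)" by simp
qed auto

text \<open>
  A partial matrix supported on \<open>E\<close> is given by a function \<open>m\<close> on index pairs of which only
  the values on \<open>E\<close> are used.
\<close>

definition completion ::
  "nat \<Rightarrow> nat \<Rightarrow> (nat \<times> nat) set \<Rightarrow> (nat \<times> nat \<Rightarrow> real) \<Rightarrow> real mat \<Rightarrow> bool" where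
  "completion p q E m M \<longleftrightarrow> M \<in> carrier_mat p q \<and> (\<forall>ij\<in>E. M $$ ij = m ij)"

end

theory Submission
  imports Defs
begin

text \<open>
  For a nonnegative matrix, nonnegative rank 2 and rank 2 are the same thing. In any relation among
  three nonnegative vectors, one of them lies in the cone spanned by the other two. If the rank is at
  most 2, all triples of columns satisfy a relation, so, adding the columns one at a time, two
  columns can be kept whose cone contains all the others; they form the left factor of a nonnegative
  factorization. If the rank is at most 1, one of these two columns suffices.
\<close>

section \<open>Rank bounds and linear relations among columns\<close>

text \<open>The rank is the size of a maximal independent set of columns, and the exchange lemma
  bounds the size of an independent subset of \<open>span S\<close>.\<close>

lemma (in vec_space) rank_le_card_spanning:
  assumes A: "A \<in> carrier_mat n nc"
    and S: "finite S" "S \<subseteq> carrier_vec n" "set (cols A) \<subseteq> span S"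
  shows "rank A \<le> card S"
proof -
  obtain U where U: "finite U" "maximal U (\<lambda>T. T \<subseteq> set (cols A) \<and> lin_indpt T)"
  proof -
    have "lin_indpt {}"
      by (auto simp: lin_dep_def)
    then show ?thesis
      using maximal_exists_superset[of "set (cols A)" "\<lambda>T. T \<subseteq> set (cols A) \<and> lin_indpt T" "{}"] that
      by auto
  qed
  then have "U \<subseteq> span S" "lin_indpt U"
    using S unfolding maximal_def by auto
  \<comment> \<open>\<open>replacement\<close> bounds a cardinality by this difference, so the
    difference is nonnegative.\<close>
  then obtain C :: "'a vec set" where "int (card C) \<le> int (card S) - int (card U)"
    using replacement[of U S] U(1) S by blast
  then show ?thesis
    using rank_card_indpt[OF A U(2)] by linarith
qed

text \<open>Each column of \<open>A * B\<close> is \<open>A\<close> applied to a column of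
  \<open>B\<close>, so it lies in the span of the at most \<open>r\<close> columns of
  \<open>A\<close>.\<close>

lemma (in vec_space) rank_mult_le:
  assumes A: "A \<in> carrier_mat n r" and B: "B \<in> carrier_mat r nc"
  shows "rank (A * B) \<le> r"
proof -
  have "set (cols (A * B)) \<subseteq> span (set (cols A))"
  proof
    fix v assume "v \<in> set (cols (A * B))"
    then obtain j where "j < nc" "v = col (A * B) j"
      using A B by (auto simp: cols_def)
    then have "v = A *\<^sub>v col B j" "col B j \<in> carrier_vec r"
      using A B by (auto simp: col_mult2)
    then have "v \<in> col_space A"
      using A by (auto simp: col_space_eq)
    then show "v \<in> span (set (cols A))"
      by (simp add: col_space_def)
  qed
  then have "rank (A * B) \<le> card (set (cols A))"
    using A B cols_dim[of A] by (intro rank_le_card_spanning[of _ nc]) auto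
  also have "\<dots> \<le> r"
    using A card_length[of "cols A"] by simp
  finally show ?thesis .
qed

text \<open>Columns are counted by index, so equal columns have to be treated apart: two of them
  give the relation with coefficients 1 and -1. Distinct columns form a set larger than the rank,
  hence a dependent one.\<close>

lemma (in vec_space) rank_less_card_imp_col_relation:
  assumes A: "A \<in> carrier_mat n nc"
    and J: "J \<subseteq> {..<nc}" "rank A < card J"
  shows "\<exists>c. (\<exists>j\<in>J. c j \<noteq> 0) \<and> (\<forall>i<n. (\<Sum>j\<in>J. c j * A $$ (i, j)) = 0)"
proof (cases "inj_on (col A) J")
  case True
  let ?U = "col A ` J"
  have fin: "finite J"
    using J finite_subset by blast
  have U: "?U \<subseteq> set (cols A)"
    using A J by (auto simp: cols_def)
  then have carrier: "?U \<subseteq> carrier_vec n"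
    using A cols_dim[of A] by auto
  have "lin_dep ?U"
    using rank_ge_card_indpt[OF A U] J card_image[OF True] by linarith
  then obtain a v where a: "lincomb a ?U = 0\<^sub>v n" "v \<in> ?U" "a v \<noteq> 0"
    using finite_lin_dep[of ?U] fin carrier by auto
  have "(\<Sum>j\<in>J. a (col A j) * A $$ (i, j)) = 0" if i: "i < n" for i
  proof -
    have "(\<Sum>j\<in>J. a (col A j) * A $$ (i, j)) = (\<Sum>v\<in>?U. a v * v $ i)"
      unfolding sum.reindex[OF True] using A J i by (intro sum.cong) auto
    also have "\<dots> = 0"
      using lincomb_index[OF i carrier, of a] a i by simp
    finally show ?thesis .
  qed
  then show ?thesis
    using a by (intro exI[of _ "\<lambda>j. a (col A j)"]) auto
next
  case False
  then obtain j k where jk: "j \<in> J" "k \<in> J" "j \<noteq> k" "col A j = col A k"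
    by (auto simp: inj_on_def)
  then have "j < nc" "k < nc"
    using J by auto
  let ?c = "\<lambda>l. if l = j then 1 else if l = k then - 1 else 0"
  have fin: "finite J"
    using J finite_subset by blast
  have "(\<Sum>l\<in>J. ?c l * A $$ (i, l)) = 0" if i: "i < n" for i
  proof -
    have "(\<Sum>l\<in>J. ?c l * A $$ (i, l)) = (\<Sum>l\<in>{j, k}. ?c l * A $$ (i, l))"
      using jk fin by (intro sum.mono_neutral_right) auto
    also have "\<dots> = col A j $ i - col A k $ i"
      using jk(3) i A \<open>j < nc\<close> \<open>k < nc\<close> by simp
    finally show ?thesis
      using jk by simp
  qed
  then show ?thesis
    using jk by (intro exI[of _ ?c]) auto
qed

section \<open>Cones spanned by two vectors\<close>

text \<open>Vectors are functions compared on \<open>I\<close> only, so matrix columns can be used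
  directly. The generators may coincide; \<open>in_cone I a a\<close> describes the ray of
  \<open>a\<close>.\<close>

definition in_cone :: "'i set \<Rightarrow> ('i \<Rightarrow> real) \<Rightarrow> ('i \<Rightarrow> real) \<Rightarrow> ('i \<Rightarrow> real) \<Rightarrow> bool" where
  "in_cone I a b c \<longleftrightarrow> (\<exists>s\<ge>0. \<exists>t\<ge>0. \<forall>i\<in>I. c i = s * a i + t * b i)"

lemma in_coneI: "s \<ge> 0 \<Longrightarrow> t \<ge> 0 \<Longrightarrow> (\<And>i. i \<in> I \<Longrightarrow> c i = s * a i + t * b i) \<Longrightarrow> in_cone I a b c"
  by (auto simp: in_cone_def)

lemma in_cone_left [simp]: "in_cone I a b a"
  by (rule in_coneI[of 1 0]) auto

lemma in_cone_right [simp]: "in_cone I a b b"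
  by (rule in_coneI[of 0 1]) auto

lemma in_cone_trans:
  assumes "in_cone I a b c" "in_cone I d e a" "in_cone I d e b"
  shows "in_cone I d e c"
proof -
  obtain s t where 1: "s \<ge> 0" "t \<ge> 0" "\<forall>i\<in>I. c i = s * a i + t * b i"
    using assms(1) by (auto simp: in_cone_def)
  obtain s1 t1 where 2: "s1 \<ge> 0" "t1 \<ge> 0" "\<forall>i\<in>I. a i = s1 * d i + t1 * e i"
    using assms(2) by (auto simp: in_cone_def)
  obtain s2 t2 where 3: "s2 \<ge> 0" "t2 \<ge> 0" "\<forall>i\<in>I. b i = s2 * d i + t2 * e i"
    using assms(3) by (auto simp: in_cone_def)
  show ?thesis
    using 1 2 3
    by (intro in_coneI[of "s * s1 + t * s2" "s * t1 + t * t2"]) (auto simp: algebra_simps)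
qed

text \<open>Solve the relation for \<open>a\<close>; the signs make both quotients
  nonnegative.\<close>

lemma in_cone_if_relation:
  assumes "x > 0" "y \<le> 0" "z \<le> 0" "\<And>i. i \<in> I \<Longrightarrow> x * a i + y * b i + z * c i = 0"
  shows "in_cone I b c a"
proof (rule in_coneI)
  show "a i = (- y / x) * b i + (- z / x) * c i" if "i \<in> I" for i
    using assms(1) assms(4)[OF that] by (simp add: field_simps)
qed (use assms in \<open>auto simp: divide_nonpos_pos\<close>)

text \<open>Up to an overall sign, at most one coefficient of a relation among three vectors is positive;
  if none is, then nonnegativity makes the vectors that occur in the relation vanish.\<close>

lemma nonneg_relation_imp_in_cone:
  assumes nonneg: "\<And>i. i \<in> I \<Longrightarrow> a i \<ge> 0" "\<And>i. i \<in> I \<Longrightarrow> b i \<ge> 0" "\<And>i. i \<in> I \<Longrightarrow> c i \<ge> 0"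
    and rel: "\<And>i. i \<in> I \<Longrightarrow> x * a i + y * b i + z * c i = 0"
    and nz: "x \<noteq> 0 \<or> y \<noteq> 0 \<or> z \<noteq> 0"
  shows "in_cone I b c a \<or> in_cone I a c b \<or> in_cone I a b c"
proof -
  \<comment> \<open>Having the coefficients as parameters lets the facts below apply to the relation
    and to its negative.\<close>
  define good where
    "good x y z \<longleftrightarrow> (\<forall>i\<in>I. x * a i + y * b i + z * c i = 0) \<and> (x \<noteq> 0 \<or> y \<noteq> 0 \<or> z \<noteq> 0)" for x y z
  have one_pos: ?thesis if g: "good x y z" and
    s: "x > 0 \<and> y \<le> 0 \<and> z \<le> 0 \<or> y > 0 \<and> x \<le> 0 \<and> z \<le> 0 \<or> z > 0 \<and> x \<le> 0 \<and> y \<le> 0" for x y z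
    using s
  proof (elim disjE conjE)
    assume "x > 0" "y \<le> 0" "z \<le> 0"
    then have "in_cone I b c a"
      using g by (intro in_cone_if_relation[of x y z]) (auto simp: good_def)
    then show ?thesis by blast
  next
    assume "y > 0" "x \<le> 0" "z \<le> 0"
    then have "in_cone I a c b"
      using g by (intro in_cone_if_relation[of y x z]) (auto simp: good_def algebra_simps)
    then show ?thesis by blast
  next
    assume "z > 0" "x \<le> 0" "y \<le> 0"
    then have "in_cone I a b c"
      using g by (intro in_cone_if_relation[of z x y]) (auto simp: good_def algebra_simps)
    then show ?thesis by blast
  qed
  have all_nonneg: ?thesis if g: "good x y z" and s: "x \<ge> 0" "y \<ge> 0" "z \<ge> 0" for x y z
  proof -
    have "x * a i = 0 \<and> y * b i = 0 \<and> z * c i = 0" if "i \<in> I" for i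
      using that g s nonneg[OF that]
      unfolding good_def by (smt (verit) mult_nonneg_nonneg)
    then have "(\<forall>i\<in>I. a i = 0) \<or> (\<forall>i\<in>I. b i = 0) \<or> (\<forall>i\<in>I. c i = 0)"
      using g by (auto simp: good_def)
    then show ?thesis
      by (auto intro: in_coneI[of 0 0])
  qed
  have "(- x) * a i + (- y) * b i + (- z) * c i = 0" if "i \<in> I" for i
    using rel[OF that] by linarith
  then have g: "good x y z" "good (- x) (- y) (- z)"
    using rel nz by (auto simp: good_def)
  \<comment> \<open>If no coefficient is negative, or none is positive, \<open>all_nonneg\<close>
    applies to the relation or to its negative. Otherwise both signs occur, and one of the two has
    exactly one positive coefficient.\<close>
  show ?thesis
    using one_pos[OF g(1)] one_pos[OF g(2)] all_nonneg[OF g(1)] all_nonneg[OF g(2)]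
    by linarith
qed

text \<open>Coefficients of opposite signs make each vector a positive multiple of the other.
  Otherwise both terms vanish, and a vector with nonzero coefficient is zero, so it lies in every
  cone.\<close>

lemma nonneg_relation_of_two_imp_in_cone:
  assumes nonneg: "\<And>i. i \<in> I \<Longrightarrow> a i \<ge> 0" "\<And>i. i \<in> I \<Longrightarrow> b i \<ge> 0"
    and rel: "\<And>i. i \<in> I \<Longrightarrow> x * a i + y * b i = 0"
    and nz: "x \<noteq> 0 \<or> y \<noteq> 0"
  shows "in_cone I b b a \<or> in_cone I a a b"
proof (cases "x * y < 0")
  case True
  then consider "x > 0" "y < 0" | "x < 0" "y > 0"
    by (auto simp: mult_less_0_iff)
  then show ?thesis
  proof cases
    case 1
    then show ?thesis
      using rel in_cone_if_relation[of x y 0 I a b b] by simp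
  next
    case 2
    then show ?thesis
      using rel in_cone_if_relation[of y x 0 I b a a] by (simp add: add.commute)
  qed
next
  case False
  have "x * a i = 0 \<and> y * b i = 0" if "i \<in> I" for i
  proof (cases "x \<ge> 0 \<and> y \<ge> 0")
    case True
    then show ?thesis
      using rel[OF that] nonneg[OF that] by (simp add: add_nonneg_eq_0_iff)
  next
    case sign: False
    then have "- x \<ge> 0" "- y \<ge> 0"
      using False by (auto simp: mult_less_0_iff not_less)
    moreover have "(- x) * a i + (- y) * b i = 0"
      using rel[OF that] by simp
    ultimately show ?thesis
      using nonneg[OF that] add_nonneg_eq_0_iff[of "(- x) * a i" "(- y) * b i"]
      by (metis mult_nonneg_nonneg mult_minus_left neg_equal_0_iff_equal)
  qed
  then have "(\<forall>i\<in>I. a i = 0) \<or> (\<forall>i\<in>I. b i = 0)"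
    using nz by auto
  then show ?thesis
    by (auto intro: in_coneI[of 0 0])
qed

text \<open>Induction on \<open>J\<close>: of the two current generators and the new vector, one
  lies in the cone of the other two and is dropped. By \<open>in_cone_trans\<close> the remaining
  two still generate everything.\<close>

lemma finite_family_in_cone_of_two:
  fixes f :: "'j \<Rightarrow> 'i \<Rightarrow> real"
  assumes "finite J" "J \<noteq> {}"
    and "\<And>a b c. a \<in> J \<Longrightarrow> b \<in> J \<Longrightarrow> c \<in> J \<Longrightarrow>
      in_cone I (f b) (f c) (f a) \<or> in_cone I (f a) (f c) (f b) \<or> in_cone I (f a) (f b) (f c)"
  shows "\<exists>a\<in>J. \<exists>b\<in>J. \<forall>c\<in>J. in_cone I (f a) (f b) (f c)"
  using assms
proof (induction J rule: finite_ne_induct)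
  case (singleton x)
  then show ?case by simp
next
  case (insert x J)
  then obtain a b where ab: "a \<in> J" "b \<in> J" "\<forall>c\<in>J. in_cone I (f a) (f b) (f c)"
    by (metis insert_iff)
  consider "in_cone I (f a) (f b) (f x)" | "in_cone I (f b) (f x) (f a)" | "in_cone I (f a) (f x) (f b)"
    using insert.prems[of a b x] ab by auto
  then show ?case
  proof cases
    case 1
    then show ?thesis using ab by blast
  next
    case 2
    then have "\<forall>c\<in>insert x J. in_cone I (f b) (f x) (f c)"
      using ab(3) in_cone_trans by fastforce
    then show ?thesis using ab by blast
  next
    case 3
    then have "\<forall>c\<in>insert x J. in_cone I (f a) (f x) (f c)"
      using ab(3) in_cone_trans by fastforce
    then show ?thesis using ab by blast
  qed
qed

section \<open>Nonnegative factorizations of matrices of small rank\<close>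

lemma cols_in_cone_of_two:
  assumes M: "M \<in> carrier_mat p q" and nonneg: "nonneg_mat M"
    and rank: "vec_space.rank p M \<le> 2" and "q > 0"
  obtains k l where "k < q" "l < q"
    "\<And>j. j < q \<Longrightarrow> in_cone {..<p} (\<lambda>i. M $$ (i, k)) (\<lambda>i. M $$ (i, l)) (\<lambda>i. M $$ (i, j))"
proof -
  interpret vec_space "TYPE(real)" p .
  let ?f = "\<lambda>j i. M $$ (i, j)"
  have "in_cone {..<p} (?f b) (?f c) (?f a) \<or> in_cone {..<p} (?f a) (?f c) (?f b)
      \<or> in_cone {..<p} (?f a) (?f b) (?f c)"
    if abc: "a < q" "b < q" "c < q" for a b c
  proof (cases "distinct [a, b, c]")
    case True
    then have card: "card {a, b, c} = 3" by simp
    obtain d where d: "\<exists>j\<in>{a, b, c}. d j \<noteq> 0" "\<forall>i<p. (\<Sum>j\<in>{a, b, c}. d j * M $$ (i, j)) = 0"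
      using rank_less_card_imp_col_relation[OF M, of "{a, b, c}"] card rank abc by auto
    show ?thesis
      using d True abc nonneg M
      by (intro nonneg_relation_imp_in_cone[of _ _ _ _ "d a" "d b" "d c"])
        (auto simp: nonneg_mat_def)
  next
    \<comment> \<open>With a repeated index, one of the three vectors is itself a generator.\<close>
    case False
    then show ?thesis by auto
  qed
  then have "\<exists>k\<in>{..<q}. \<exists>l\<in>{..<q}. \<forall>j\<in>{..<q}. in_cone {..<p} (?f k) (?f l) (?f j)"
    using \<open>q > 0\<close> by (intro finite_family_in_cone_of_two) auto
  then show ?thesis
    using that by auto
qed

lemma nonneg_factorization_2_if_rank_le_2:
  assumes M: "M \<in> carrier_mat p q" and nonneg: "nonneg_mat M"
    and rank: "vec_space.rank p M \<le> 2" and "q > 0"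
  shows "nonneg_factorization 2 M"
proof -
  obtain k l where kl: "k < q" "l < q"
    "\<And>j. j < q \<Longrightarrow> in_cone {..<p} (\<lambda>i. M $$ (i, k)) (\<lambda>i. M $$ (i, l)) (\<lambda>i. M $$ (i, j))"
    using cols_in_cone_of_two[OF assms] by blast
  \<comment> \<open>The guard \<open>j < q\<close> stands under the existential so that choice
    yields total functions \<open>s\<close> and \<open>t\<close>.\<close>
  then have "\<forall>j. \<exists>s t. j < q \<longrightarrow> s \<ge> 0 \<and> t \<ge> 0 \<and> (\<forall>i<p. M $$ (i, j) = s * M $$ (i, k) + t * M $$ (i, l))"
    unfolding in_cone_def by (metis lessThan_iff)
  then obtain s t where st: "\<And>j. j < q \<Longrightarrow> s j \<ge> 0" "\<And>j. j < q \<Longrightarrow> t j \<ge> 0"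
    "\<And>i j. i < p \<Longrightarrow> j < q \<Longrightarrow> M $$ (i, j) = s j * M $$ (i, k) + t j * M $$ (i, l)"
    by metis
  \<comment> \<open>The generating columns \<open>k\<close> and \<open>l\<close> form
    \<open>A\<close>; the cone coefficients of the columns of \<open>M\<close> form
    \<open>B\<close>.\<close>
  define A where "A = mat p 2 (\<lambda>(i, r). M $$ (i, if r = 0 then k else l))"
  define B where "B = mat 2 q (\<lambda>(r, j). if r = 0 then s j else t j)"
  have "M = A * B"
    using M st
    by (intro eq_matI) (auto simp: A_def B_def scalar_prod_def numeral_2_eq_2)
  moreover have "nonneg_mat A" "nonneg_mat B"
    using nonneg M kl(1,2) st(1,2) by (auto simp: nonneg_mat_def A_def B_def)
  moreover have "A \<in> carrier_mat (dim_row M) 2" "B \<in> carrier_mat 2 (dim_col M)"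
    using M by (auto simp: A_def B_def)
  ultimately show ?thesis
    unfolding nonneg_factorization_def by blast
qed

text \<open>The two generating columns now satisfy a relation themselves, so one lies on the ray of
  the other, and the latter generates all columns alone.\<close>

lemma nonneg_factorization_1_if_rank_le_1:
  assumes M: "M \<in> carrier_mat p q" and nonneg: "nonneg_mat M"
    and rank: "vec_space.rank p M \<le> 1" and "q > 0"
  shows "nonneg_factorization 1 M"
proof -
  interpret vec_space "TYPE(real)" p .
  let ?f = "\<lambda>j i. M $$ (i, j)"
  obtain k l where kl: "k < q" "l < q" "\<And>j. j < q \<Longrightarrow> in_cone {..<p} (?f k) (?f l) (?f j)"
    using cols_in_cone_of_two[OF M nonneg le_trans[OF rank one_le_numeral] \<open>q > 0\<close>] by blast
  have "in_cone {..<p} (?f k) (?f k) (?f l) \<or> in_cone {..<p} (?f l) (?f l) (?f k)"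
  proof (cases "k = l")
    case False
    then have card: "card {k, l} = 2" by simp
    obtain d where d: "\<exists>j\<in>{k, l}. d j \<noteq> 0" "\<forall>i<p. (\<Sum>j\<in>{k, l}. d j * M $$ (i, j)) = 0"
      using rank_less_card_imp_col_relation[OF M, of "{k, l}"] card rank kl(1,2) by auto
    show ?thesis
      using d False kl(1,2) nonneg M
      by (intro nonneg_relation_of_two_imp_in_cone[of _ _ _ "d l" "d k"])
        (auto simp: nonneg_mat_def add.commute)
  qed simp
  then obtain a where a: "a < q" "\<And>j. j < q \<Longrightarrow> in_cone {..<p} (?f a) (?f a) (?f j)"
  proof (elim disjE)
    assume "in_cone {..<p} (?f k) (?f k) (?f l)"
    then show ?thesis
      using kl in_cone_trans[OF kl(3) in_cone_left] that[of k] by blast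
  next
    assume "in_cone {..<p} (?f l) (?f l) (?f k)"
    then show ?thesis
      using kl in_cone_trans[OF kl(3) _ in_cone_left] that[of l] by blast
  qed
  have "\<exists>s\<ge>0. \<forall>i<p. M $$ (i, j) = s * M $$ (i, a)" if "j < q" for j
  proof -
    obtain s t where "s \<ge> 0" "t \<ge> 0" "\<forall>i\<in>{..<p}. M $$ (i, j) = s * M $$ (i, a) + t * M $$ (i, a)"
      using a(2)[OF \<open>j < q\<close>] by (auto simp: in_cone_def)
    \<comment> \<open>Both generators are column \<open>a\<close>, so the coefficients add
      up.\<close>
    then show ?thesis
      by (intro exI[of _ "s + t"]) (auto simp: distrib_right)
  qed
  then obtain s where s: "\<And>j. j < q \<Longrightarrow> s j \<ge> 0"
    "\<And>i j. i < p \<Longrightarrow> j < q \<Longrightarrow> M $$ (i, j) = s j * M $$ (i, a)"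
    by metis
  define A where "A = mat p 1 (\<lambda>(i, _). M $$ (i, a))"
  define B where "B = mat 1 q (\<lambda>(_, j). s j)"
  have "M = A * B"
    using M s by (intro eq_matI) (auto simp: A_def B_def scalar_prod_def)
  moreover have "nonneg_mat A" "nonneg_mat B"
    using nonneg M a(1) s(1) by (auto simp: nonneg_mat_def A_def B_def)
  moreover have "A \<in> carrier_mat (dim_row M) 1" "B \<in> carrier_mat 1 (dim_col M)"
    using M by (auto simp: A_def B_def)
  ultimately show ?thesis
    unfolding nonneg_factorization_def by blast
qed

section \<open>Comparison of rank and nonnegative rank\<close>

lemma rank_le_if_nonneg_factorization:
  assumes "M \<in> carrier_mat p q" "nonneg_factorization r M"
  shows "vec_space.rank p M \<le> r"
  using assms vec_space.rank_mult_le unfolding nonneg_factorization_def by blast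

text \<open>The rank never exceeds the nonnegative rank, while rank at most 1 or 2 yields a
  nonnegative factorization of inner dimension 1 or 2.\<close>

lemma nonneg_rank_eq_2_iff:
  assumes M: "M \<in> carrier_mat p q" and nonneg: "nonneg_mat M" and q: "q > 0"
  shows "nonneg_rank M = 2 \<longleftrightarrow> vec_space.rank p M = 2"
proof
  assume 2: "nonneg_rank M = 2"
  \<comment> \<open>The \<open>LEAST\<close> is attained because the factorization through the
    identity matrix exists.\<close>
  have "nonneg_factorization (nonneg_rank M) M"
    unfolding nonneg_rank_def using nonneg_factorization_dim_col[OF nonneg] by (rule LeastI)
  then have "vec_space.rank p M \<le> 2"
    using rank_le_if_nonneg_factorization[OF M] 2 by metis
  moreover have "\<not> vec_space.rank p M \<le> 1"
  proof
    assume "vec_space.rank p M \<le> 1"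
    then have "nonneg_rank M \<le> 1"
      unfolding nonneg_rank_def
      using nonneg_factorization_1_if_rank_le_1[OF M nonneg _ q] by (intro Least_le)
    then show False using 2 by simp
  qed
  ultimately show "vec_space.rank p M = 2" by linarith
next
  assume 2: "vec_space.rank p M = 2"
  show "nonneg_rank M = 2"
    unfolding nonneg_rank_def
  proof (rule Least_equality)
    show "nonneg_factorization 2 M"
      using nonneg_factorization_2_if_rank_le_2[OF M nonneg _ q] 2 by simp
    show "2 \<le> r" if "nonneg_factorization r M" for r
      using rank_le_if_nonneg_factorization[OF M that] 2 by simp
  qed
qed

theorem proposition3p5:
  fixes p q :: nat
    and E :: "(nat \<times> nat) set"
    and m :: "nat \<times> nat \<Rightarrow> real"
  assumes "p > 0" and "q > 0"
    and "E \<subseteq> {0..<p} \<times> {0..<q}"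
    and "\<forall>ij\<in>E. m ij \<ge> 0"
  shows "(\<exists>M. completion p q E m M \<and> nonneg_mat M \<and> nonneg_rank M = 2) \<longleftrightarrow>
         (\<exists>M. completion p q E m M \<and> vec_space.rank p M = 2 \<and> nonneg_mat M)"
  \<comment> \<open>The same completion serves as witness on both sides.\<close>
  using nonneg_rank_eq_2_iff[OF _ _ \<open>q > 0\<close>] unfolding completion_def by blast

end
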